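(* Let an $N$-player linear-quadratic generalized Nash game with shared affine constraints be given as in the context, with monotone pseudogradient $\phi(x)=Fx+f$, and let $F_s=\tfrac12(F+F^\top)$, with $F_s\ne 0$. Assume that the game has a v-GNE. Let $z^k=(x^k,\lambda^k,\nu^k)$, $k\ge 0$, be the iterates of the accelerated projected gradient procedure described in the context. Then $x^k$ is an $\mathcal{O}(1/k^2)$-approximated generalized Nash equilibrium of the game, i.e. there is a constant $C\ge 0$ independent of $k$ such that for every $k\ge 1$ the point $x^k$ is a $(C/k^2)$-approximated generalized Nash equilibrium.
   Context: Game. There are $N$ players; player $i\in\{1,\dots,N\}$ chooses $x_i\in\mathbb{R}^{n_i}$, and $x=(x_1,\dots,x_N)\in\mathbb{R}^n$, $n=\sum_i n_i$; $x_{-i}$ denotes all components of $x$ other than $x_i$, and $x=(x_i,x_{-i})$. Player $i$ minimizes over $x_i$ the cost $J_i(x)=\tfrac12 x^\top Q^{(i)}x+(c^{(i)})^\top x$, with $Q^{(i)}\in\mathbb{R}^{n\times n}$ symmetric and $c^{(i)}\in\mathbb{R}^n$, subject to the shared constraint $x\in\mathcal{X}=\{x\in\mathbb{R}^n: Ax\le b,\ Ex=e\}$, where $A\in\mathbb{R}^{m\times n}$, $b\in\mathbb{R}^m$, $E\in\mathbb{R}^{q\times n}$, $e\in\mathbb{R}^q$, $m,q\ge 0$. Vector inequalities are componentwise; $\|\cdot\|$ (or $\|\cdot\|_2$) is the Euclidean norm for vectors and $\|\cdot\|_2$ the spectral norm for matrices. Pseudogradient. $\phi(x)=Fx+f$,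 obtained by stacking $\nabla_{x_i}J_i(x)$, i.e. the $i$-th block of rows of $F\in\mathbb{R}^{n\times n}$ (the $n_i$ rows indexed by the coordinates of $x_i$) equals the $i$-th block of rows of $Q^{(i)}$, and the $i$-th block of $f\in\mathbb{R}^n$ equals the $i$-th block of $c^{(i)}$. Standing assumption. $\phi$ is monotone: $(\phi(x)-\phi(y))^\top(x-y)\ge 0$ for all $x,y\in\mathbb{R}^n$ (equivalently $F_s\succeq 0$). v-GNE. A v-GNE is a point $x^\star\in\mathcal{X}$ with $\phi(x^\star)^\top(y-x^\star)\ge0$ for all $y\in\mathcal{X}$. $\varepsilon$-approximated GNE. A point $x^\varepsilon\in\mathcal{X}$ is an $\varepsilon$-approximated generalized Nash equilibrium if for every player $i$ and every $z_i\in\mathbb{R}^{n_i}$ with $(z_i,x^\varepsilon_{-i})\in\mathcal{X}$ one has $J_i(x_i^\varepsilon,x_{-i}^\varepsilon)\le J_i(z_i,x_{-i}^\varepsilon)+\varepsilon$. Accelerated projected gradient procedure. Let $\mathcal{Z}=\{(x,\lambda,\nu)\in\mathbb{R}^{n+m+q}: Fx+f+A^\top\lambda+E^\top\nu=0,\ Ex=e,\ Ax\le b,\ \lambda\ge0\}$ and $L=2\|F_s\|_2$. Start from some $z^0\in\mathcal{Z}$, $y^0=z^0$, $\theta_0=1$. For $k=0,1,2,\dots$, writing $y^k=(\bar x^k,\bar\lambda^k,\bar\nu^k)$: $g^k=(f+2F_s\bar x^k,\ b,\ e)\in\mathbb{R}^{n+m+q}$ (the gradient at $y^k$ of $x^\top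 F_sx+f^\top x+b^\top\lambda+e^\top\nu$); $z^{k+1}=\arg\min_{z\in\mathcal{Z}}\|z-(y^k-\tfrac1L g^k)\|_2^2$; $\theta_{k+1}=\tfrac12\theta_k\bigl(\sqrt{\theta_k^2+4}-\theta_k\bigr)$; $y^{k+1}=z^{k+1}+\theta_{k+1}\bigl(\tfrac1{\theta_k}-1\bigr)(z^{k+1}-z^k)$. *)

theory Defs
  imports "HOL-Analysis.Analysis"
begin

text \<open>
  The joint strategy space is \<open>real ^ 'n\<close>, with \<open>'n\<close> the set of all coordinates and \<open>'p\<close> the set
  of players. The coordinate \<open>j\<close> belongs to the block of player \<open>owner G j\<close>, so that the dimension
  of the strategy space of player \<open>i\<close> is \<open>card {j. owner G j = i}\<close>.

  Since a type is never empty, \<open>'m\<close> and \<open>'q\<close> alone could not express that there are no inequality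
  or no equality constraints. The constraints are therefore the rows with index in \<open>ineq_rows G\<close>
  and in \<open>eq_rows G\<close>, two arbitrary, possibly empty, sets (their cardinalities are the numbers of
  constraints). Entries at other indices are ignored, and the multiplier spaces are the vectors
  that vanish at the other indices, see \<open>supported\<close>.
\<close>

record ('p, 'n :: finite, 'm :: finite, 'q :: finite) lq_game =
  owner :: "'n \<Rightarrow> 'p"
  cost_mat :: "'p \<Rightarrow> real ^ 'n ^ 'n"
  cost_vec :: "'p \<Rightarrow> real ^ 'n"
  ineq_rows :: "'m set"
  ineq_mat :: "real ^ 'n ^ 'm"
  ineq_vec :: "real ^ 'm"
  eq_rows :: "'q set"
  eq_mat :: "real ^ 'n ^ 'q"
  eq_vec :: "real ^ 'q"

definition cost :: "('p, 'n :: finite, 'm :: finite, 'q :: finite) lq_game \<Rightarrow> 'p \<Rightarrow> real ^ 'n \<Rightarrow> real"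
  where "cost G i x = 1 / 2 * (x \<bullet> (cost_mat G i *v x)) + cost_vec G i \<bullet> x"

definition feasible :: "('p, 'n :: finite, 'm :: finite, 'q :: finite) lq_game \<Rightarrow> (real ^ 'n) set"
  where "feasible G =
    {x. (\<forall>r\<in>ineq_rows G. (ineq_mat G *v x) $ r \<le> ineq_vec G $ r) \<and>
        (\<forall>r\<in>eq_rows G. (eq_mat G *v x) $ r = eq_vec G $ r)}"

text \<open>The pseudogradient: row \<open>j\<close> is taken from the cost of the player who owns coordinate \<open>j\<close>.\<close>

definition pg_mat :: "('p, 'n :: finite, 'm :: finite, 'q :: finite) lq_game \<Rightarrow> real ^ 'n ^ 'n"
  where "pg_mat G = (\<chi> j. cost_mat G (owner G j) $ j)"

definition pg_vec :: "('p, 'n :: finite, 'm :: finite, 'q :: finite) lq_game \<Rightarrow> real ^ 'n"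
  where "pg_vec G = (\<chi> j. cost_vec G (owner G j) $ j)"

definition pseudogradient ::
    "('p, 'n :: finite, 'm :: finite, 'q :: finite) lq_game \<Rightarrow> real ^ 'n \<Rightarrow> real ^ 'n"
  where "pseudogradient G x = pg_mat G *v x + pg_vec G"

definition pg_sym :: "('p, 'n :: finite, 'm :: finite, 'q :: finite) lq_game \<Rightarrow> real ^ 'n ^ 'n"
  where "pg_sym G = (1 / 2) *\<^sub>R (pg_mat G + transpose (pg_mat G))"

definition monotone_game :: "('p, 'n :: finite, 'm :: finite, 'q :: finite) lq_game \<Rightarrow> bool"
  where "monotone_game G \<longleftrightarrow>
    (\<forall>x y. (pseudogradient G x - pseudogradient G y) \<bullet> (x - y) \<ge> 0)"

definition v_GNE :: "('p, 'n :: finite, 'm :: finite, 'q :: finite) lq_game \<Rightarrow> real ^ 'n \<Rightarrow> bool"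
  where "v_GNE G x \<longleftrightarrow>
    x \<in> feasible G \<and> (\<forall>y\<in>feasible G. pseudogradient G x \<bullet> (y - x) \<ge> 0)"

text \<open>The point \<open>(z\<^sub>i, x\<^sub>-\<^sub>i)\<close>; only the coordinates of \<open>z\<close> owned by player \<open>i\<close> matter.\<close>

definition deviate ::
    "('p, 'n :: finite, 'm :: finite, 'q :: finite) lq_game \<Rightarrow> 'p \<Rightarrow> real ^ 'n \<Rightarrow> real ^ 'n \<Rightarrow> real ^ 'n"
  where "deviate G i z x = (\<chi> j. if owner G j = i then z $ j else x $ j)"

definition approx_GNE ::
    "('p, 'n :: finite, 'm :: finite, 'q :: finite) lq_game \<Rightarrow> real \<Rightarrow> real ^ 'n \<Rightarrow> bool"
  where "approx_GNE G \<epsilon> x \<longleftrightarrow>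
    x \<in> feasible G \<and>
    (\<forall>i z. deviate G i z x \<in> feasible G \<longrightarrow> cost G i x \<le> cost G i (deviate G i z x) + \<epsilon>)"

text \<open>The vectors supported on \<open>I\<close> are the Euclidean space with index set \<open>I\<close>, which may be empty.\<close>

definition supported :: "'a set \<Rightarrow> real ^ 'a :: finite \<Rightarrow> bool"
  where "supported I v \<longleftrightarrow> (\<forall>r. r \<notin> I \<longrightarrow> v $ r = 0)"

definition restrict_vec :: "'a set \<Rightarrow> real ^ 'a :: finite \<Rightarrow> real ^ 'a"
  where "restrict_vec I v = (\<chi> r. if r \<in> I then v $ r else 0)"

definition primal_dual_set ::
    "('p, 'n :: finite, 'm :: finite, 'q :: finite) lq_game \<Rightarrow> ((real ^ 'n) \<times> (real ^ 'm) \<times> (real ^ 'q)) set"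
  where "primal_dual_set G =
    {(x, \<mu>, \<nu>). supported (ineq_rows G) \<mu> \<and> supported (eq_rows G) \<nu> \<and>
        pg_mat G *v x + pg_vec G + transpose (ineq_mat G) *v \<mu> + transpose (eq_mat G) *v \<nu> = 0 \<and>
        x \<in> feasible G \<and>
        (\<forall>r\<in>ineq_rows G. \<mu> $ r \<ge> 0)}"

text \<open>The operator norm with respect to Euclidean norms is the spectral norm of the matrix.\<close>

definition apg_L :: "('p, 'n :: finite, 'm :: finite, 'q :: finite) lq_game \<Rightarrow> real"
  where "apg_L G = 2 * onorm (\<lambda>x. pg_sym G *v x)"

definition apg_grad ::
    "('p, 'n :: finite, 'm :: finite, 'q :: finite) lq_game \<Rightarrow>
      (real ^ 'n) \<times> (real ^ 'm) \<times> (real ^ 'q) \<Rightarrow> (real ^ 'n) \<times> (real ^ 'm) \<times> (real ^ 'q)"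
  where "apg_grad G y =
    (pg_vec G + 2 *\<^sub>R (pg_sym G *v fst y),
     restrict_vec (ineq_rows G) (ineq_vec G),
     restrict_vec (eq_rows G) (eq_vec G))"

text \<open>
  The norm on the product type is the Euclidean norm of the concatenated vectors.
\<close>

definition apg_run ::
    "('p, 'n :: finite, 'm :: finite, 'q :: finite) lq_game \<Rightarrow>
      (nat \<Rightarrow> (real ^ 'n) \<times> (real ^ 'm) \<times> (real ^ 'q)) \<Rightarrow>
      (nat \<Rightarrow> (real ^ 'n) \<times> (real ^ 'm) \<times> (real ^ 'q)) \<Rightarrow> (nat \<Rightarrow> real) \<Rightarrow> bool"
  where "apg_run G z y \<theta> \<longleftrightarrow>
    z 0 \<in> primal_dual_set G \<and> y 0 = z 0 \<and> \<theta> 0 = 1 \<and>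
    (\<forall>k. is_arg_min (\<lambda>w. (norm (w - (y k - (1 / apg_L G) *\<^sub>R apg_grad G (y k))))\<^sup>2)
            (\<lambda>w. w \<in> primal_dual_set G) (z (Suc k)) \<and>
         \<theta> (Suc k) = 1 / 2 * \<theta> k * (sqrt ((\<theta> k)\<^sup>2 + 4) - \<theta> k) \<and>
         y (Suc k) = z (Suc k) + (\<theta> (Suc k) * (1 / \<theta> k - 1)) *\<^sub>R (z (Suc k) - z k))"

end

theory Submission
  imports Defs
begin

text \<open>
  On the primal-dual set, the objective \<open>x \<bullet> F\<^sub>s x + f \<bullet> x + b \<bullet> \<mu> + e \<bullet> \<nu>\<close> of the projected gradient
  procedure equals the complementarity gap \<open>\<mu> \<bullet> (b - A x) \<ge> 0\<close>, and Farkas' lemma provides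
  multipliers with which a v-GNE has gap \<open>0\<close>. Acceleration therefore makes the gap of the iterates
  \<open>O(1/k\<^sup>2)\<close>. The gap of \<open>x\<close> bounds what player \<open>i\<close> can gain by deviating to \<open>x + d\<close>: since \<open>d\<close> is
  supported on the block of \<open>i\<close>, the cost changes by \<open>\<phi>(x) \<bullet> d + 1/2 d \<bullet> F d\<close>, where \<open>d \<bullet> F d \<ge> 0\<close> by
  monotonicity, and \<open>\<phi>(x) \<bullet> d = \<mu> \<bullet> (b - A (x + d)) - \<mu> \<bullet> (b - A x)\<close>.
\<close>

section \<open>Accelerated projected gradient descent\<close>

text \<open>\<open>t\<close> is the positive root of
  \<open>t\<^sup>2 + s\<^sup>2 * t = s\<^sup>2\<close>. This identity later makes the energy of the
  accelerated method telescope.\<close>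

lemma momentum_step_props:
  fixes s t :: real
  assumes "0 < s" and "t = 1 / 2 * s * (sqrt (s\<^sup>2 + 4) - s)"
  shows "0 < t" and "t\<^sup>2 = (1 - t) * s\<^sup>2" and "t < 1"
proof -
  define r where "r = sqrt (s\<^sup>2 + 4)"
  have r2: "r\<^sup>2 = s\<^sup>2 + 4" and "0 \<le> r" by (simp_all add: r_def)
  have "s < r" using power2_less_imp_less[of s r] \<open>0 \<le> r\<close> r2 by linarith
  have t: "t = 1 / 2 * s * (r - s)" using assms(2) by (simp add: r_def)
  show "0 < t" using assms(1) \<open>s < r\<close> by (simp add: t)
  have "t\<^sup>2 - (1 - t) * s\<^sup>2 = s\<^sup>2 / 4 * (r\<^sup>2 - s\<^sup>2 - 4)"
    by (simp add: t power2_eq_square field_simps)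
  then show eq: "t\<^sup>2 = (1 - t) * s\<^sup>2" using r2 by simp
  with \<open>0 < t\<close> have "0 < (1 - t) * s\<^sup>2" by (metis zero_less_power)
  then show "t < 1" by (simp add: zero_less_mult_iff)
qed

text \<open>For reciprocals \<open>S = 1 / \<theta> k\<close> and
  \<open>T = 1 / \<theta> (Suc k)\<close> the quadratic identity reads
  \<open>S\<^sup>2 = T\<^sup>2 - T\<close>. Completing the square gives
  \<open>S \<le> T - 1 / 2\<close>, so the reciprocals start at 1 and grow by at least 1/2 per
  step.\<close>

lemma momentum_bound:
  fixes \<theta> :: "nat \<Rightarrow> real"
  assumes "\<theta> 0 = 1"
    and "\<And>k. \<theta> (Suc k) = 1 / 2 * \<theta> k * (sqrt ((\<theta> k)\<^sup>2 + 4) - \<theta> k)"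
  shows "0 < \<theta> k" and "\<theta> k \<le> 2 / (real k + 2)"
proof -
  have pos: "0 < \<theta> k" for k
  proof (induction k)
    case (Suc k)
    then show ?case using momentum_step_props(1)[OF _ assms(2)] by simp
  qed (simp add: assms)
  then show "0 < \<theta> k" .
  have "(real k + 2) / 2 \<le> 1 / \<theta> k" for k
  proof (induction k)
    case (Suc k)
    let ?s = "1 / \<theta> k" and ?t = "1 / \<theta> (Suc k)"
    have "(\<theta> (Suc k))\<^sup>2 = (1 - \<theta> (Suc k)) * (\<theta> k)\<^sup>2" and lt: "\<theta> (Suc k) < 1"
      using momentum_step_props(2,3)[OF pos assms(2)] by simp_all
    then have "?s\<^sup>2 = ?t\<^sup>2 - ?t"
      using pos[of k] pos[of "Suc k"] by (simp add: field_simps power2_eq_square)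
    then have "?s\<^sup>2 \<le> (?t - 1 / 2)\<^sup>2" by (simp add: power2_diff)
    moreover have "0 \<le> ?t - 1 / 2"
    proof -
      have "1 < ?t" using lt pos[of "Suc k"] by simp
      then show ?thesis by linarith
    qed
    ultimately have "?s \<le> ?t - 1 / 2" by (rule power2_le_imp_le)
    with Suc show ?case by simp
  qed (simp add: assms)
  from this[of k] show "\<theta> k \<le> 2 / (real k + 2)"
    using pos[of k] by (simp add: field_simps)
qed

text \<open>The tangent bound from \<open>y\<close> to \<open>w\<close>, the quadratic bound from
  \<open>y\<close> to \<open>p\<close> and the variational inequality of the projection add up to
  the claim. The bounds on \<open>h\<close> are global because the extrapolated point
  \<open>y\<close> may lie outside \<open>S\<close>.\<close>

lemma projected_gradient_step:
  fixes h :: "'a::real_inner \<Rightarrow> real" and g :: "'a \<Rightarrow> 'a"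
  assumes "convex S" and "0 < L"
    and lower: "\<And>u v. h u + g u \<bullet> (v - u) \<le> h v"
    and upper: "\<And>u v. h v \<le> h u + g u \<bullet> (v - u) + L / 2 * (norm (v - u))\<^sup>2"
    and proj: "is_arg_min (\<lambda>w. (norm (w - (y - (1 / L) *\<^sub>R g y)))\<^sup>2) (\<lambda>w. w \<in> S) p"
    and "w \<in> S"
  shows "h p \<le> h w + L / 2 * ((norm (w - y))\<^sup>2 - (norm (w - p))\<^sup>2)"
proof -
  let ?a = "y - (1 / L) *\<^sub>R g y"
  have "p \<in> S" and min: "\<And>v. v \<in> S \<Longrightarrow> norm (p - ?a) \<le> norm (v - ?a)"
    using proj by (auto simp: is_arg_min_linorder)
  \<comment> \<open>The projection sees \<open>S\<close> under an obtuse angle: otherwise some point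
    of the segment from \<open>p\<close> to \<open>w\<close> would be closer to
    \<open>?a\<close>.\<close>
  have "(?a - p) \<bullet> (w - p) \<le> 0"
  proof (rule ccontr)
    assume "\<not> ?thesis"
    then obtain u where u: "0 < u" "u \<le> 1" "dist (p + u *\<^sub>R (w - p)) ?a < dist p ?a"
      using closer_point_lemma[of ?a p w] by auto
    have "p + u *\<^sub>R (w - p) = (1 - u) *\<^sub>R p + u *\<^sub>R w" by (simp add: algebra_simps)
    also have "\<dots> \<in> S" using convexD_alt[OF assms(1) \<open>p \<in> S\<close> \<open>w \<in> S\<close>, of u] u by simp
    finally show False using min u(3) by (force simp: dist_norm)
  qed
  then have "L * ((?a - p) \<bullet> (w - p)) \<le> 0" using \<open>0 < L\<close> by (simp add: mult_le_0_iff)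
  then have "L * ((y - p) \<bullet> (w - p)) \<le> g y \<bullet> (w - p)"
    using \<open>0 < L\<close> by (simp add: inner_diff_left algebra_simps)
  \<comment> \<open>This three-point identity trades the inner product for the squared distances of
    the claim.\<close>
  moreover have "(norm (w - y))\<^sup>2 - (norm (w - p))\<^sup>2 = (norm (p - y))\<^sup>2 - 2 * ((y - p) \<bullet> (w - p))"
    by (simp add: power2_norm_eq_inner inner_diff inner_commute algebra_simps)
  then have "L / 2 * ((norm (w - y))\<^sup>2 - (norm (w - p))\<^sup>2)
      = L / 2 * (norm (p - y))\<^sup>2 - L * ((y - p) \<bullet> (w - p))"
    by (simp only: right_diff_distrib)
  moreover have "h p \<le> h w - g y \<bullet> (w - p) + L / 2 * (norm (p - y))\<^sup>2"
    using lower[of y w] upper[of p y] by (simp add: inner_diff_right)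
  ultimately show ?thesis by linarith
qed

text \<open>Comparing the step with the convex combination of \<open>z k\<close> and \<open>w\<close> makes the energy
  \<open>(h (z (k + 1)) - h w) / \<theta>\<^sub>k\<^sup>2 + L / 2 * \<parallel>v (k + 1) - w\<parallel>\<^sup>2\<close> decreasing, where the auxiliary points
  \<open>v\<close> satisfy \<open>y k = (1 - \<theta>\<^sub>k) z k + \<theta>\<^sub>k v k\<close>.\<close>

lemma accelerated_projected_gradient_bound:
  fixes h :: "'a::real_inner \<Rightarrow> real" and g :: "'a \<Rightarrow> 'a" and z y :: "nat \<Rightarrow> 'a"
  assumes "convex S" and "0 < L"
    and lower: "\<And>u v. h u + g u \<bullet> (v - u) \<le> h v"
    and upper: "\<And>u v. h v \<le> h u + g u \<bullet> (v - u) + L / 2 * (norm (v - u))\<^sup>2"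
    and "z 0 \<in> S" and "y 0 = z 0" and "\<theta> 0 = 1"
    and proj: "\<And>k. is_arg_min (\<lambda>w. (norm (w - (y k - (1 / L) *\<^sub>R g (y k))))\<^sup>2)
                 (\<lambda>w. w \<in> S) (z (Suc k))"
    and \<theta>: "\<And>k. \<theta> (Suc k) = 1 / 2 * \<theta> k * (sqrt ((\<theta> k)\<^sup>2 + 4) - \<theta> k)"
    and y: "\<And>k. y (Suc k) = z (Suc k) + (\<theta> (Suc k) * (1 / \<theta> k - 1)) *\<^sub>R (z (Suc k) - z k)"
    and "w \<in> S"
  shows "h (z (Suc k)) - h w \<le> (\<theta> k)\<^sup>2 * (L / 2 * (norm (z 0 - w))\<^sup>2)"
proof -
  \<comment> \<open>\<open>v (Suc j)\<close> prolongs the step from \<open>z j\<close> to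
    \<open>z (Suc j)\<close> by the factor \<open>1 / \<theta> j\<close>, so that
    \<open>z (Suc j) = (1 - \<theta> j) z j + \<theta> j v (Suc j)\<close>.\<close>
  define v where "v k = (case k of 0 \<Rightarrow> z 0 | Suc j \<Rightarrow> z j + (1 / \<theta> j) *\<^sub>R (z (Suc j) - z j))" for k
  have v0: "v 0 = z 0" and vS: "\<And>k. v (Suc k) = z k + (1 / \<theta> k) *\<^sub>R (z (Suc k) - z k)"
    by (simp_all add: v_def)
  have pos: "0 < \<theta> k" for k using momentum_bound(1)[OF \<open>\<theta> 0 = 1\<close> \<theta>] .
  have le1: "\<theta> k \<le> 1" for k
    using momentum_step_props(3)[OF pos \<theta>] \<open>\<theta> 0 = 1\<close> by (cases k) (auto intro: less_imp_le)
  have yv: "y k = (1 - \<theta> k) *\<^sub>R z k + \<theta> k *\<^sub>R v k" for k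
  proof (cases k)
    case 0
    then show ?thesis using \<open>y 0 = z 0\<close> \<open>\<theta> 0 = 1\<close> by (simp add: v0)
  next
    case (Suc j)
    then show ?thesis by (simp add: y vS algebra_simps)
  qed
  have zS: "z k \<in> S" for k
    using proj \<open>z 0 \<in> S\<close> by (cases k) (auto simp: is_arg_min_def)
  have step: "(h (z (Suc k)) - h w) / (\<theta> k)\<^sup>2 + L / 2 * (norm (v (Suc k) - w))\<^sup>2
      \<le> (1 - \<theta> k) / (\<theta> k)\<^sup>2 * (h (z k) - h w) + L / 2 * (norm (v k - w))\<^sup>2" for k
  proof -
    define u where "u = (1 - \<theta> k) *\<^sub>R z k + \<theta> k *\<^sub>R w"
    have "u \<in> S"
      using convexD_alt[OF \<open>convex S\<close> zS \<open>w \<in> S\<close>, of "\<theta> k"] pos[of k] le1[of k]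
      by (simp add: u_def)
    \<comment> \<open>Jensen's inequality at \<open>u\<close>: in the average of the two tangent
      bounds at \<open>u\<close> the linear terms cancel.\<close>
    have "(1 - \<theta> k) * (h u + g u \<bullet> (z k - u)) + \<theta> k * (h u + g u \<bullet> (w - u))
        \<le> (1 - \<theta> k) * h (z k) + \<theta> k * h w"
      using pos[of k] le1[of k] by (intro add_mono mult_left_mono lower) auto
    moreover have "(1 - \<theta> k) * (h u + g u \<bullet> (z k - u)) + \<theta> k * (h u + g u \<bullet> (w - u))
        = h u + g u \<bullet> ((1 - \<theta> k) *\<^sub>R (z k - u) + \<theta> k *\<^sub>R (w - u))"
      unfolding inner_add_right inner_scaleR_right by algebra
    moreover have "(1 - \<theta> k) *\<^sub>R (z k - u) + \<theta> k *\<^sub>R (w - u) = 0"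
      by (simp add: u_def algebra_simps)
    ultimately have hu: "h u \<le> (1 - \<theta> k) * h (z k) + \<theta> k * h w" by simp
    \<comment> \<open>\<open>z k\<close> cancels from both differences. The squared distances
      therefore carry the factor \<open>(\<theta> k)\<^sup>2\<close>, which the final division
      removes.\<close>
    have "u - y k = \<theta> k *\<^sub>R (w - v k)" by (simp add: u_def yv algebra_simps)
    then have uy: "(norm (u - y k))\<^sup>2 = (\<theta> k)\<^sup>2 * (norm (v k - w))\<^sup>2"
      by (simp add: power_mult_distrib norm_minus_commute)
    have "u - z (Suc k) = \<theta> k *\<^sub>R (w - v (Suc k))"
      using pos[of k] by (simp add: u_def vS algebra_simps)
    then have uz: "(norm (u - z (Suc k)))\<^sup>2 = (\<theta> k)\<^sup>2 * (norm (v (Suc k) - w))\<^sup>2"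
      by (simp add: power_mult_distrib norm_minus_commute)
    have "h (z (Suc k)) \<le> h u + L / 2 * ((norm (u - y k))\<^sup>2 - (norm (u - z (Suc k)))\<^sup>2)"
      by (rule projected_gradient_step[OF \<open>convex S\<close> \<open>0 < L\<close> lower upper proj \<open>u \<in> S\<close>])
    then have "h (z (Suc k)) - h w \<le> (1 - \<theta> k) * (h (z k) - h w)
        + (\<theta> k)\<^sup>2 * (L / 2 * (norm (v k - w))\<^sup>2 - L / 2 * (norm (v (Suc k) - w))\<^sup>2)"
      using hu by (simp add: uy uz algebra_simps)
    then have "(h (z (Suc k)) - h w) / (\<theta> k)\<^sup>2 \<le> ((1 - \<theta> k) * (h (z k) - h w)
        + (\<theta> k)\<^sup>2 * (L / 2 * (norm (v k - w))\<^sup>2 - L / 2 * (norm (v (Suc k) - w))\<^sup>2)) / (\<theta> k)\<^sup>2"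
      by (rule divide_right_mono) simp
    then show ?thesis using pos[of k] by (simp add: add_divide_distrib)
  qed
  have "(h (z (Suc k)) - h w) / (\<theta> k)\<^sup>2 + L / 2 * (norm (v (Suc k) - w))\<^sup>2
      \<le> L / 2 * (norm (z 0 - w))\<^sup>2" for k
  proof (induction k)
    case 0
    \<comment> \<open>Since \<open>\<theta> 0 = 1\<close>, the term with \<open>h (z 0)\<close>
      vanishes, and the bound depends on the starting point only through its distance to
      \<open>w\<close>.\<close>
    then show ?case using step[of 0] \<open>\<theta> 0 = 1\<close> by (simp add: v0)
  next
    case (Suc k)
    \<comment> \<open>The weight of the old error in the new step equals its weight in the previous
      energy, so the energies chain.\<close>
    have "(1 - \<theta> (Suc k)) / (\<theta> (Suc k))\<^sup>2 = 1 / (\<theta> k)\<^sup>2"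
      using momentum_step_props(2)[OF pos \<theta>, of k] pos[of k] pos[of "Suc k"]
      by (simp add: field_simps)
    with step[of "Suc k"] Suc show ?case by (simp only: times_divide_eq_left mult_1_left)
  qed
  from this[of k] have "(h (z (Suc k)) - h w) / (\<theta> k)\<^sup>2
      \<le> L / 2 * (norm (z 0 - w))\<^sup>2 - L / 2 * (norm (v (Suc k) - w))\<^sup>2"
    by linarith
  also have "\<dots> \<le> L / 2 * (norm (z 0 - w))\<^sup>2" using \<open>0 < L\<close> by simp
  finally have "(h (z (Suc k)) - h w) / (\<theta> k)\<^sup>2 \<le> L / 2 * (norm (z 0 - w))\<^sup>2" .
  then show ?thesis using pos[of k] by (simp add: pos_divide_le_eq mult.commute)
qed

theorem accelerated_projected_gradient_rate:
  fixes h :: "'a::real_inner \<Rightarrow> real" and g :: "'a \<Rightarrow> 'a" and z y :: "nat \<Rightarrow> 'a"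
  assumes "convex S" and "0 < L"
    and "\<And>u v. h u + g u \<bullet> (v - u) \<le> h v"
    and "\<And>u v. h v \<le> h u + g u \<bullet> (v - u) + L / 2 * (norm (v - u))\<^sup>2"
    and "z 0 \<in> S" and "y 0 = z 0" and \<theta>0: "\<theta> 0 = 1"
    and "\<And>k. is_arg_min (\<lambda>w. (norm (w - (y k - (1 / L) *\<^sub>R g (y k))))\<^sup>2)
           (\<lambda>w. w \<in> S) (z (Suc k))"
    and \<theta>: "\<And>k. \<theta> (Suc k) = 1 / 2 * \<theta> k * (sqrt ((\<theta> k)\<^sup>2 + 4) - \<theta> k)"
    and "\<And>k. y (Suc k) = z (Suc k) + (\<theta> (Suc k) * (1 / \<theta> k - 1)) *\<^sub>R (z (Suc k) - z k)"
    and "w \<in> S" and "1 \<le> k"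
  shows "h (z k) - h w \<le> 2 * L * (norm (z 0 - w))\<^sup>2 / (real k)\<^sup>2"
proof -
  obtain j where j: "k = Suc j" using \<open>1 \<le> k\<close> by (cases k) auto
  let ?D = "L / 2 * (norm (z 0 - w))\<^sup>2"
  have "0 \<le> ?D" using \<open>0 < L\<close> by simp
  \<comment> \<open>The iterate with index \<open>k = Suc j\<close> is controlled by
    \<open>\<theta> j\<close>, which is at most \<open>2 / (k + 1)\<close>.\<close>
  have "\<theta> j \<le> 2 / (real j + 2)" by (rule momentum_bound(2)[OF \<theta>0 \<theta>])
  also have "\<dots> \<le> 2 / real k" by (simp add: j frac_le)
  finally have "(\<theta> j)\<^sup>2 \<le> (2 / real k)\<^sup>2"
    using momentum_bound(1)[OF \<theta>0 \<theta>, of j] by (intro power_mono) auto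
  with \<open>0 \<le> ?D\<close> have "(\<theta> j)\<^sup>2 * ?D \<le> (2 / real k)\<^sup>2 * ?D" by (intro mult_right_mono)
  moreover have "h (z k) - h w \<le> (\<theta> j)\<^sup>2 * ?D"
    unfolding j by (rule accelerated_projected_gradient_bound[OF assms(1-11)])
  ultimately show ?thesis by (simp add: power_divide)
qed

section \<open>Farkas' lemma and optimality conditions\<close>

text \<open>A finitely generated cone is closed, so a vector \<open>c\<close> outside it can be
  strictly separated from it; the negated normal then contradicts \<open>pol\<close>.\<close>

lemma farkas_mixed:
  fixes a :: "'i \<Rightarrow> 'a::euclidean_space" and b :: "'j \<Rightarrow> 'a"
  assumes "finite I" and "finite J"
    and pol: "\<And>d. (\<And>i. i \<in> I \<Longrightarrow> a i \<bullet> d \<le> 0) \<Longrightarrow> (\<And>j. j \<in> J \<Longrightarrow> b j \<bullet> d = 0) \<Longrightarrow> c \<bullet> d \<le> 0"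
  shows "\<exists>l u. (\<forall>i\<in>I. 0 \<le> l i) \<and> c = (\<Sum>i\<in>I. l i *\<^sub>R a i) + (\<Sum>j\<in>J. u j *\<^sub>R b j)"
proof -
  let ?comb = "\<lambda>l u. (\<Sum>i\<in>I. l i *\<^sub>R a i) + (\<Sum>j\<in>J. u j *\<^sub>R b j)"
  \<comment> \<open>\<open>K\<close> collects the explicit combinations, while \<open>H\<close> is
    the hull known to be closed. Each equality generator enters \<open>S\<close> with both signs,
    which leaves its coefficient free. The inclusion of \<open>H\<close> in \<open>K\<close>
    recovers coefficients.\<close>
  define K where "K = {x. \<exists>l u. (\<forall>i\<in>I. (0::real) \<le> l i) \<and> x = ?comb l u}"
  define S where "S = a ` I \<union> b ` J \<union> (\<lambda>j. - b j) ` J"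
  define H where "H = convex_cone hull S"
  have KI: "x \<in> K" if "\<forall>i\<in>I. 0 \<le> l i" "x = ?comb l u" for x l u
    using that unfolding K_def by blast
  have "convex_cone K"
    unfolding convex_cone_iff
  proof (intro conjI ballI allI impI)
    have "0 = ?comb (\<lambda>_. 0) (\<lambda>_. 0)" by simp
    then show "0 \<in> K" by (rule KI[rotated]) simp
  next
    fix x y assume "x \<in> K" "y \<in> K"
    then obtain l u l' u' where "\<forall>i\<in>I. 0 \<le> l i" "x = ?comb l u" "\<forall>i\<in>I. 0 \<le> l' i" "y = ?comb l' u'"
      unfolding K_def by blast
    then have "x + y = ?comb (\<lambda>i. l i + l' i) (\<lambda>j. u j + u' j)" "\<forall>i\<in>I. 0 \<le> l i + l' i"
      by (simp_all add: scaleR_add_left sum.distrib)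
    then show "x + y \<in> K" by (rule KI[rotated])
  next
    fix x and r :: real assume "x \<in> K" "0 \<le> r"
    then obtain l u where "\<forall>i\<in>I. 0 \<le> l i" "x = ?comb l u"
      unfolding K_def by blast
    with \<open>0 \<le> r\<close> have "r *\<^sub>R x = ?comb (\<lambda>i. r * l i) (\<lambda>j. r * u j)" "\<forall>i\<in>I. 0 \<le> r * l i"
      by (simp_all add: scaleR_add_right scaleR_sum_right)
    then show "r *\<^sub>R x \<in> K" by (rule KI[rotated])
  qed
  moreover have "S \<subseteq> K"
  proof -
    have "a i \<in> K" if "i \<in> I" for i
    proof -
      have "a i = ?comb (\<lambda>i'. if i' = i then 1 else 0) (\<lambda>_. 0)"
        using that \<open>finite I\<close> by (simp add: if_distrib[of "\<lambda>t. t *\<^sub>R _"] sum.delta cong: if_cong)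
      then show ?thesis by (rule KI[rotated]) simp
    qed
    moreover have "s *\<^sub>R b j \<in> K" if "j \<in> J" for j s
    proof -
      have "s *\<^sub>R b j = ?comb (\<lambda>_. 0) (\<lambda>j'. if j' = j then s else 0)"
        using that \<open>finite J\<close> by (simp add: if_distrib[of "\<lambda>t. t *\<^sub>R _"] sum.delta cong: if_cong)
      then show ?thesis by (rule KI[rotated]) simp
    qed
    from this[of _ 1] this[of _ "-1"] have "\<And>j. j \<in> J \<Longrightarrow> b j \<in> K" "\<And>j. j \<in> J \<Longrightarrow> - b j \<in> K"
      by simp_all
    ultimately show ?thesis unfolding S_def by blast
  qed
  ultimately have "H \<subseteq> K" unfolding H_def by (simp add: hull_minimal)
  have cone: "convex_cone H" unfolding H_def by (rule convex_cone_convex_cone_hull)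
  have "c \<in> H"
  proof (rule ccontr)
    assume "c \<notin> H"
    moreover have "closed H" "convex H"
      using assms(1,2) unfolding H_def S_def
      by (auto intro!: closed_convex_cone_hull convex_convex_cone_hull)
    ultimately obtain d \<beta> where d: "d \<bullet> c < \<beta>" "\<And>x. x \<in> H \<Longrightarrow> \<beta> < d \<bullet> x"
      using separating_hyperplane_closed_point by metis
    have "\<beta> < 0" using d(2)[OF convex_cone_contains_0[OF cone]] by simp
    \<comment> \<open>A point with negative value could be rescaled within the cone until its value
      is exactly \<open>\<beta>\<close>, against strict separation.\<close>
    have nonneg: "0 \<le> d \<bullet> x" if "x \<in> H" for x
    proof (rule ccontr)
      assume neg: "\<not> 0 \<le> d \<bullet> x"
      with \<open>\<beta> < 0\<close> have "0 \<le> \<beta> / (d \<bullet> x)" by (simp add: divide_nonpos_nonpos)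
      then have "\<beta> < d \<bullet> ((\<beta> / (d \<bullet> x)) *\<^sub>R x)" by (intro d(2) convex_cone_scaleR[OF cone] that)
      with neg show False by simp
    qed
    have "S \<subseteq> H" unfolding H_def by (rule hull_subset)
    then have "0 \<le> d \<bullet> a i" if "i \<in> I" for i using that unfolding S_def by (blast intro: nonneg)
    moreover have "d \<bullet> b j = 0" if "j \<in> J" for j
      using that \<open>S \<subseteq> H\<close> nonneg[of "b j"] nonneg[of "- b j"] unfolding S_def
      by (simp add: image_subset_iff)
    ultimately have "c \<bullet> - d \<le> 0" by (intro pol) (simp_all add: inner_commute)
    with d(1) \<open>\<beta> < 0\<close> show False by (simp add: inner_commute)
  qed
  with \<open>H \<subseteq> K\<close> show ?thesis unfolding K_def by blast
qed

lemma transpose_mult_vec_inner: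
  fixes A :: "real ^ 'n ^ 'm"
  shows "(transpose A *v u) \<bullet> x = u \<bullet> (A *v x)"
  by (simp add: dot_lmul_matrix)

text \<open>With affine constraints, a direction that respects the active inequalities and the
  equalities stays feasible for a short step, so \<open>c\<close> cannot decrease along it. Farkas'
  lemma for the active rows gives multipliers; extending them by zero yields support and
  complementarity.\<close>

lemma kkt_multipliers:
  fixes A :: "real ^ 'n ^ 'm" and E :: "real ^ 'n ^ 'q"
  assumes ineq: "\<And>r. r \<in> I \<Longrightarrow> (A *v x) $ r \<le> b $ r"
    and eq: "\<And>r. r \<in> J \<Longrightarrow> (E *v x) $ r = e $ r"
    and opt: "\<And>y. (\<And>r. r \<in> I \<Longrightarrow> (A *v y) $ r \<le> b $ r) \<Longrightarrow>
                (\<And>r. r \<in> J \<Longrightarrow> (E *v y) $ r = e $ r) \<Longrightarrow> 0 \<le> c \<bullet> (y - x)"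
  shows "\<exists>\<mu> \<nu>. supported I \<mu> \<and> supported J \<nu> \<and> (\<forall>r. 0 \<le> \<mu> $ r) \<and>
           (\<forall>r. \<mu> $ r \<noteq> 0 \<longrightarrow> (A *v x) $ r = b $ r) \<and>
           c + transpose A *v \<mu> + transpose E *v \<nu> = 0"
proof -
  define act where "act = {r \<in> I. (A *v x) $ r = b $ r}"
  have dir: "- c \<bullet> d \<le> 0"
    if A0: "\<And>r. r \<in> act \<Longrightarrow> A $ r \<bullet> d \<le> 0" and E0: "\<And>r. r \<in> J \<Longrightarrow> E $ r \<bullet> d = 0" for d
  proof -
    have "\<forall>r\<in>I. \<exists>t>0. \<forall>s. 0 < s \<and> s \<le> t \<longrightarrow> (A *v (x + s *\<^sub>R d)) $ r \<le> b $ r"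
    proof
      fix r assume "r \<in> I"
      show "\<exists>t>0. \<forall>s. 0 < s \<and> s \<le> t \<longrightarrow> (A *v (x + s *\<^sub>R d)) $ r \<le> b $ r"
      proof (cases "A $ r \<bullet> d \<le> 0")
        case True
        have "s * (A $ r \<bullet> d) \<le> 0" if "0 < s" for s using True that by (simp add: mult_le_0_iff)
        then show ?thesis using ineq[OF \<open>r \<in> I\<close>]
          by (intro exI[of _ 1]) (force simp: matrix_vector_mul_component inner_add_right)
      next
        case False
        with A0 \<open>r \<in> I\<close> have "(A *v x) $ r \<noteq> b $ r" by (auto simp: act_def)
        with ineq[OF \<open>r \<in> I\<close>] have gap: "0 < b $ r - A $ r \<bullet> x"
          by (simp add: matrix_vector_mul_component)
        \<comment> \<open>The bound on the step is the ratio at which the inactive constraint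
          \<open>r\<close> becomes tight.\<close>
        with False show ?thesis
          by (intro exI[of _ "(b $ r - A $ r \<bullet> x) / (A $ r \<bullet> d)"])
             (auto simp: matrix_vector_mul_component inner_add_right field_simps)
      qed
    qed
    then obtain t where t: "\<And>r. r \<in> I \<Longrightarrow> 0 < t r"
      "\<And>r s. r \<in> I \<Longrightarrow> 0 < s \<Longrightarrow> s \<le> t r \<Longrightarrow> (A *v (x + s *\<^sub>R d)) $ r \<le> b $ r"
      by metis
    \<comment> \<open>The inserted 1 keeps the minimum well defined when there are no
      inequalities.\<close>
    define s where "s = Min (insert 1 (t ` I))"
    have "0 < s" unfolding s_def using t(1) by (subst Min_gr_iff) auto
    moreover have "s \<le> t r" if "r \<in> I" for r unfolding s_def using that by (intro Min_le) auto
    ultimately have "(A *v (x + s *\<^sub>R d)) $ r \<le> b $ r" if "r \<in> I" for r using t(2) that by blast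
    moreover have "(E *v (x + s *\<^sub>R d)) $ r = e $ r" if "r \<in> J" for r
      using eq[OF that] E0[OF that] by (simp add: matrix_vector_mul_component inner_add_right)
    ultimately have "0 \<le> c \<bullet> (x + s *\<^sub>R d - x)" by (rule opt)
    with \<open>0 < s\<close> show ?thesis by (simp add: zero_le_mult_iff)
  qed
  from farkas_mixed[of act J "\<lambda>r. A $ r" "\<lambda>r. E $ r" "- c", OF finite finite dir]
  obtain l u where l: "\<forall>r\<in>act. 0 \<le> l r"
    and lu: "- c = (\<Sum>r\<in>act. l r *\<^sub>R A $ r) + (\<Sum>r\<in>J. u r *\<^sub>R E $ r)"
    by blast
  define \<mu> where "\<mu> = (\<chi> r. if r \<in> act then l r else 0)"
  define \<nu> where "\<nu> = (\<chi> r. if r \<in> J then u r else 0)"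
  have "(transpose A *v \<mu> + transpose E *v \<nu>) \<bullet> d = - c \<bullet> d" for d
  proof -
    have "\<mu> \<bullet> (A *v d) = (\<Sum>r\<in>act. l r * (A $ r \<bullet> d))"
      unfolding inner_vec_def[of _ "A *v d"] \<mu>_def
      by (rule sum.mono_neutral_cong_right) (auto simp: matrix_vector_mul_component)
    moreover have "\<nu> \<bullet> (E *v d) = (\<Sum>r\<in>J. u r * (E $ r \<bullet> d))"
      unfolding inner_vec_def[of _ "E *v d"] \<nu>_def
      by (rule sum.mono_neutral_cong_right) (auto simp: matrix_vector_mul_component)
    ultimately show ?thesis
      unfolding lu inner_add_left transpose_mult_vec_inner by (simp add: inner_sum_left)
  qed
  then have "transpose A *v \<mu> + transpose E *v \<nu> = - c" by (metis vector_eq_rdot)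
  then have "c + transpose A *v \<mu> + transpose E *v \<nu> = 0" by (simp add: add.assoc)
  moreover have "supported I \<mu>" "supported J \<nu>" "\<forall>r. 0 \<le> \<mu> $ r"
    "\<forall>r. \<mu> $ r \<noteq> 0 \<longrightarrow> (A *v x) $ r = b $ r"
    using l by (auto simp: supported_def \<mu>_def \<nu>_def act_def)
  ultimately show ?thesis by blast
qed

section \<open>Linear-quadratic games\<close>

text \<open>The objective with gradient \<open>apg_grad\<close>, defined on the whole space because
  the extrapolated points may leave the primal-dual set. The name refers to its value on that
  set.\<close>

definition dual_gap ::
    "('p, 'n :: finite, 'm :: finite, 'q :: finite) lq_game \<Rightarrow>
      (real ^ 'n) \<times> (real ^ 'm) \<times> (real ^ 'q) \<Rightarrow> real"
  where "dual_gap G = (\<lambda>(x, \<mu>, \<nu>). x \<bullet> (pg_sym G *v x) + pg_vec G \<bullet> x +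
    restrict_vec (ineq_rows G) (ineq_vec G) \<bullet> \<mu> + restrict_vec (eq_rows G) (eq_vec G) \<bullet> \<nu>)"

lemma restrict_vec_inner_supported:
  assumes "supported I v"
  shows "restrict_vec I u \<bullet> v = u \<bullet> v"
  unfolding inner_vec_def restrict_vec_def
  using assms by (intro sum.cong) (auto simp: supported_def)

text \<open>For \<open>x = y\<close> this says that \<open>pg_mat\<close> and its symmetric part
  have the same quadratic form.\<close>

lemma pg_sym_inner: "x \<bullet> (pg_sym G *v y) = (x \<bullet> (pg_mat G *v y) + y \<bullet> (pg_mat G *v x)) / 2"
proof -
  have "x \<bullet> (transpose (pg_mat G) *v y) = y \<bullet> (pg_mat G *v x)"
    by (metis inner_commute transpose_mult_vec_inner)
  then show ?thesis
    unfolding pg_sym_def scaleR_matrix_vector_assoc[symmetric] matrix_vector_mult_add_rdistrib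
    by (simp add: inner_add_right del: transpose_matrix_vector)
qed

lemma pg_sym_inner_commute: "x \<bullet> (pg_sym G *v y) = y \<bullet> (pg_sym G *v x)"
  by (simp add: pg_sym_inner)

lemma pg_mat_psd:
  assumes "monotone_game G"
  shows "0 \<le> d \<bullet> (pg_mat G *v d)"
  using assms[unfolded monotone_game_def, rule_format, of d 0]
  by (simp add: pseudogradient_def inner_commute)

lemma apg_L_pos:
  assumes "pg_sym G \<noteq> 0"
  shows "0 < apg_L G"
proof -
  have "\<exists>x. pg_sym G *v x \<noteq> 0"
    using assms by (metis matrix_eq matrix_vector_mult_0)
  then show ?thesis
    by (simp add: apg_L_def onorm_pos_lt)
qed

lemma pg_sym_quadratic_le: "d \<bullet> (pg_sym G *v d) \<le> apg_L G / 2 * (norm d)\<^sup>2"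
proof -
  have "d \<bullet> (pg_sym G *v d) \<le> norm d * norm (pg_sym G *v d)" by (rule norm_cauchy_schwarz)
  also have "\<dots> \<le> norm d * (onorm ((*v) (pg_sym G)) * norm d)"
    by (intro mult_left_mono onorm) auto
  finally show ?thesis by (simp add: apg_L_def power2_eq_square algebra_simps)
qed

text \<open>The objective is quadratic, so its second-order Taylor formula is exact, with curvature
  only in the primal component. Monotonicity bounds the remainder below by zero, and the spectral
  norm bounds it above.\<close>

lemma dual_gap_expansion:
  "dual_gap G v = dual_gap G u + apg_grad G u \<bullet> (v - u) +
    (fst v - fst u) \<bullet> (pg_sym G *v (fst v - fst u))"
proof -
  obtain x \<mu> \<nu> x' \<mu>' \<nu>' where "u = (x, \<mu>, \<nu>)" and "v = (x', \<mu>', \<nu>')" by (metis surj_pair)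
  then show ?thesis
    using pg_sym_inner_commute[of x G x']
    by (simp add: dual_gap_def apg_grad_def inner_add_left inner_diff_left inner_diff_right
        matrix_vector_mult_diff_distrib inner_commute[of "pg_sym G *v _"] algebra_simps)
qed

lemma dual_gap_lower:
  assumes "monotone_game G"
  shows "dual_gap G u + apg_grad G u \<bullet> (v - u) \<le> dual_gap G v"
  using pg_mat_psd[OF assms, of "fst v - fst u"]
  by (simp add: dual_gap_expansion[of G v u] pg_sym_inner)

lemma dual_gap_upper:
  assumes "pg_sym G \<noteq> 0"
  shows "dual_gap G v \<le> dual_gap G u + apg_grad G u \<bullet> (v - u) + apg_L G / 2 * (norm (v - u))\<^sup>2"
proof -
  have "norm (fst v - fst u) \<le> norm (v - u)" 
    using norm_fst_le[of "fst (v - u)" "snd (v - u)"] unfolding prod.collapse by simp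
  then have "apg_L G / 2 * (norm (fst v - fst u))\<^sup>2 \<le> apg_L G / 2 * (norm (v - u))\<^sup>2"
    using less_imp_le[OF apg_L_pos[OF assms]] by (intro mult_left_mono power_mono) simp_all
  with pg_sym_quadratic_le[of "fst v - fst u" G] show ?thesis
    unfolding dual_gap_expansion[of G v u] by linarith
qed

section \<open>The primal-dual set and complementarity\<close>

lemma convex_primal_dual_set: "convex (primal_dual_set G)"
proof (rule convexI)
  fix v w and s t :: real
  assume v: "v \<in> primal_dual_set G" and w: "w \<in> primal_dual_set G" and st: "0 \<le> s" "0 \<le> t" "s + t = 1"
  obtain x \<mu> \<nu> x' \<mu>' \<nu>' where vw: "v = (x, \<mu>, \<nu>)" "w = (x', \<mu>', \<nu>')" by (metis surj_pair)
  have comb: "A *v (s *\<^sub>R a + t *\<^sub>R a') = s *\<^sub>R (A *v a) + t *\<^sub>R (A *v a')"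
    for A :: "real ^ 'i ^ 'j" and a a'
    by (simp add: matrix_vector_right_distrib matrix_vector_mult_scaleR)
  have "pg_mat G *v (s *\<^sub>R x + t *\<^sub>R x') + pg_vec G
      + transpose (ineq_mat G) *v (s *\<^sub>R \<mu> + t *\<^sub>R \<mu>')
      + transpose (eq_mat G) *v (s *\<^sub>R \<nu> + t *\<^sub>R \<nu>')
    = s *\<^sub>R (pg_mat G *v x + pg_vec G + transpose (ineq_mat G) *v \<mu> + transpose (eq_mat G) *v \<nu>)
      + t *\<^sub>R (pg_mat G *v x' + pg_vec G + transpose (ineq_mat G) *v \<mu>' + transpose (eq_mat G) *v \<nu>')"
    using scaleR_add_left[of s t "pg_vec G"] st(3)
    unfolding comb by (simp add: scaleR_add_right del: transpose_matrix_vector)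
  also have "\<dots> = 0" using v w by (simp add: primal_dual_set_def vw del: transpose_matrix_vector)
  finally have stat: "pg_mat G *v (s *\<^sub>R x + t *\<^sub>R x') + pg_vec G
      + transpose (ineq_mat G) *v (s *\<^sub>R \<mu> + t *\<^sub>R \<mu>')
      + transpose (eq_mat G) *v (s *\<^sub>R \<nu> + t *\<^sub>R \<nu>') = 0" .
  \<comment> \<open>These two scalar facts settle the inequality and the equality constraints row by
    row.\<close>
  have "s * p + t * p' \<le> c" if "p \<le> c" "p' \<le> c" for p p' c :: real
    using convex_bound_le[OF that st] .
  moreover have "s * c + t * c = c" for c :: real
    using st(3) by (metis distrib_right mult_1)
  ultimately have "s *\<^sub>R x + t *\<^sub>R x' \<in> feasible G"
    using v w by (auto simp: primal_dual_set_def feasible_def vw comb)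
  with stat show "s *\<^sub>R v + t *\<^sub>R w \<in> primal_dual_set G"
    using v w st by (auto simp: primal_dual_set_def vw supported_def simp del: transpose_matrix_vector)
qed

text \<open>Pair the stationarity equation at \<open>x\<close> with \<open>y\<close>; feasibility of
  \<open>y\<close> evaluates the equality term. Keeping \<open>y\<close> apart from \<open>x\<close>
  covers both the point itself (\<open>y = x\<close>) and a player's deviation from it.\<close>

lemma primal_dual_slack:
  assumes "(x, \<mu>, \<nu>) \<in> primal_dual_set G" and "y \<in> feasible G"
  shows "pseudogradient G x \<bullet> y + ineq_vec G \<bullet> \<mu> + eq_vec G \<bullet> \<nu> =
    \<mu> \<bullet> (ineq_vec G - ineq_mat G *v y)"
proof -
  have "pseudogradient G x + transpose (ineq_mat G) *v \<mu> + transpose (eq_mat G) *v \<nu> = 0"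
    using assms(1) by (simp add: primal_dual_set_def pseudogradient_def)
  then have "(pseudogradient G x + transpose (ineq_mat G) *v \<mu> + transpose (eq_mat G) *v \<nu>) \<bullet> y = 0"
    by (simp del: transpose_matrix_vector)
  then have "pseudogradient G x \<bullet> y = - (\<mu> \<bullet> (ineq_mat G *v y)) - \<nu> \<bullet> (eq_mat G *v y)"
    unfolding inner_add_left transpose_mult_vec_inner by simp
  moreover have "\<nu> \<bullet> (eq_mat G *v y) = \<nu> \<bullet> eq_vec G"
    unfolding inner_vec_def using assms
    by (intro sum.cong) (auto simp: primal_dual_set_def feasible_def supported_def)
  ultimately show ?thesis by (simp add: inner_diff_right inner_commute)
qed

lemma primal_dual_slack_nonneg:
  assumes "(x, \<mu>, \<nu>) \<in> primal_dual_set G" and "y \<in> feasible G"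
  shows "0 \<le> \<mu> \<bullet> (ineq_vec G - ineq_mat G *v y)"
  unfolding inner_vec_def using assms
  by (intro sum_nonneg)
     (force simp: primal_dual_set_def feasible_def supported_def intro: mult_nonneg_nonneg)

lemma dual_gap_eq_slack:
  assumes "(x, \<mu>, \<nu>) \<in> primal_dual_set G"
  shows "dual_gap G (x, \<mu>, \<nu>) = \<mu> \<bullet> (ineq_vec G - ineq_mat G *v x)"
proof -
  have "supported (ineq_rows G) \<mu>" "supported (eq_rows G) \<nu>" "x \<in> feasible G"
    using assms by (auto simp: primal_dual_set_def)
  then show ?thesis
    unfolding primal_dual_slack[OF assms \<open>x \<in> feasible G\<close>, symmetric]
    by (simp add: dual_gap_def pseudogradient_def pg_sym_inner restrict_vec_inner_supported
        inner_add_left inner_commute[of x "pg_mat G *v x"])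
qed

text \<open>A v-GNE minimizes the linear function with the fixed coefficient vector
  \<open>pseudogradient G x\<close> over the feasible set. Its KKT multipliers satisfy complementary
  slackness, so the gap vanishes. This point is the comparison point for the convergence
  rate.\<close>

lemma ex_zero_dual_gap:
  assumes "v_GNE G x"
  shows "\<exists>w\<in>primal_dual_set G. dual_gap G w = 0"
proof -
  have x: "x \<in> feasible G" and opt: "\<And>y. y \<in> feasible G \<Longrightarrow> 0 \<le> pseudogradient G x \<bullet> (y - x)"
    using assms by (auto simp: v_GNE_def)
  obtain \<mu> \<nu> where "supported (ineq_rows G) \<mu>" "supported (eq_rows G) \<nu>" "\<forall>r. 0 \<le> \<mu> $ r"
    and compl: "\<forall>r. \<mu> $ r \<noteq> 0 \<longrightarrow> (ineq_mat G *v x) $ r = ineq_vec G $ r"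
    and "pseudogradient G x + transpose (ineq_mat G) *v \<mu> + transpose (eq_mat G) *v \<nu> = 0"
    using kkt_multipliers[of "ineq_rows G" "ineq_mat G" x "ineq_vec G" "eq_rows G" "eq_mat G"
        "eq_vec G" "pseudogradient G x"] x opt
    unfolding feasible_def by blast
  with x have w: "(x, \<mu>, \<nu>) \<in> primal_dual_set G"
    by (simp add: primal_dual_set_def pseudogradient_def)
  have "dual_gap G (x, \<mu>, \<nu>) = 0"
    unfolding dual_gap_eq_slack[OF w] inner_vec_def
    using compl by (intro sum.neutral) (metis diff_self inner_zero_left inner_zero_right vector_minus_component)
  with w show ?thesis by blast
qed

section \<open>Unilateral deviations\<close>

lemma cost_expansion:
  assumes "transpose (cost_mat G i) = cost_mat G i"
  shows "cost G i (x + d) = cost G i x + (cost_mat G i *v x + cost_vec G i) \<bullet> d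
    + 1 / 2 * (d \<bullet> (cost_mat G i *v d))"
proof -
  \<comment> \<open>Symmetry merges the two cross terms of the quadratic form.\<close>
  have "x \<bullet> (cost_mat G i *v d) = d \<bullet> (cost_mat G i *v x)"
    by (metis assms inner_commute transpose_mult_vec_inner)
  then show ?thesis
    by (simp add: cost_def matrix_vector_right_distrib inner_add_left inner_add_right inner_commute
        algebra_simps)
qed

text \<open>Only rows owned by player \<open>i\<close> contribute to the inner product, and there
  the two matrices agree.\<close>

lemma pg_mat_inner_block:
  assumes "\<And>j. owner G j \<noteq> i \<Longrightarrow> d $ j = 0"
  shows "(pg_mat G *v x) \<bullet> d = (cost_mat G i *v x) \<bullet> d"
  unfolding inner_vec_def[of _ d] matrix_vector_mul_component
proof (rule sum.cong)
  fix j
  show "(pg_mat G $ j \<bullet> x) \<bullet> d $ j = (cost_mat G i $ j \<bullet> x) \<bullet> d $ j"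
    using assms by (cases "owner G j = i") (simp_all add: pg_mat_def)
qed simp

lemma pg_vec_inner_block:
  assumes "\<And>j. owner G j \<noteq> i \<Longrightarrow> d $ j = 0"
  shows "pg_vec G \<bullet> d = cost_vec G i \<bullet> d"
  unfolding inner_vec_def
proof (rule sum.cong)
  fix j
  show "pg_vec G $ j \<bullet> d $ j = cost_vec G i $ j \<bullet> d $ j"
    using assms by (cases "owner G j = i") (simp_all add: pg_vec_def)
qed simp

text \<open>The second-order term of the cost along \<open>d\<close> is half the quadratic form of
  \<open>pg_mat\<close> at \<open>d\<close>, since \<open>d\<close> lies in the block of
  \<open>i\<close>. Monotonicity thus makes the cost convex in the player's own variable.\<close>

lemma cost_block_lower:
  assumes "transpose (cost_mat G i) = cost_mat G i" and "monotone_game G"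
    and block: "\<And>j. owner G j \<noteq> i \<Longrightarrow> d $ j = 0"
  shows "cost G i x + pseudogradient G x \<bullet> d \<le> cost G i (x + d)"
  using pg_mat_psd[OF assms(2), of d] pg_mat_inner_block[of G i d d, OF block]
    pg_mat_inner_block[of G i d x, OF block] pg_vec_inner_block[of G i d, OF block]
  by (simp add: cost_expansion[OF assms(1)] pseudogradient_def inner_add_left inner_commute[of d])

lemma approx_GNE_dual_gap:
  assumes "\<And>i. transpose (cost_mat G i) = cost_mat G i" and "monotone_game G"
    and "w \<in> primal_dual_set G" and "dual_gap G w \<le> \<epsilon>"
  shows "approx_GNE G \<epsilon> (fst w)"
  unfolding approx_GNE_def
proof (intro conjI allI impI)
  obtain x \<mu> \<nu> where w: "w = (x, \<mu>, \<nu>)" by (metis surj_pair)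
  with assms(3) have mem: "(x, \<mu>, \<nu>) \<in> primal_dual_set G" and x: "x \<in> feasible G"
    by (auto simp: primal_dual_set_def)
  then show "fst w \<in> feasible G" by (simp add: w)
  fix i z assume "deviate G i z (fst w) \<in> feasible G"
  then have y: "deviate G i z x \<in> feasible G" (is "?y \<in> _") by (simp add: w)
  have "cost G i x + pseudogradient G x \<bullet> (?y - x) \<le> cost G i (x + (?y - x))"
    by (rule cost_block_lower[OF assms(1,2)]) (simp add: deviate_def)
  \<comment> \<open>Subtracting the slack identities at \<open>x\<close> and at \<open>?y\<close>
    cancels the terms that depend on the multipliers alone; the slack at \<open>?y\<close> is
    nonnegative.\<close>
  moreover have "- dual_gap G w \<le> pseudogradient G x \<bullet> (?y - x)"
    using primal_dual_slack[OF mem x] primal_dual_slack[OF mem y] primal_dual_slack_nonneg[OF mem y]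
    unfolding w dual_gap_eq_slack[OF mem] by (simp add: inner_diff_right[of "pseudogradient G x"])
  ultimately show "cost G i (fst w) \<le> cost G i (deviate G i z (fst w)) + \<epsilon>"
    using assms(4) by (simp add: w)
qed

theorem proposition4p5:
  fixes G :: "('p :: finite, 'n :: finite, 'm :: finite, 'q :: finite) lq_game"
    and z y :: "nat \<Rightarrow> (real ^ 'n) \<times> (real ^ 'm) \<times> (real ^ 'q)"
    and \<theta> :: "nat \<Rightarrow> real"
  assumes "\<And>i. transpose (cost_mat G i) = cost_mat G i"
    and "monotone_game G"
    and "pg_sym G \<noteq> 0"
    and "\<exists>x. v_GNE G x"
    and "apg_run G z y \<theta>"
  shows "\<exists>C\<ge>0. \<forall>k\<ge>1. approx_GNE G (C / (real k)\<^sup>2) (fst (z k))"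
proof -
  obtain w where w: "w \<in> primal_dual_set G" "dual_gap G w = 0"
    using assms(4) ex_zero_dual_gap by blast
  \<comment> \<open>The constant of the accelerated rate for the comparison point \<open>w\<close>
    of zero gap; it depends on the starting point but not on \<open>k\<close>.\<close>
  let ?C = "2 * apg_L G * (norm (z 0 - w))\<^sup>2"
  have run: "z 0 \<in> primal_dual_set G" "y 0 = z 0" "\<theta> 0 = 1"
    "\<And>k. is_arg_min (\<lambda>w. (norm (w - (y k - (1 / apg_L G) *\<^sub>R apg_grad G (y k))))\<^sup>2)
       (\<lambda>w. w \<in> primal_dual_set G) (z (Suc k))"
    "\<And>k. \<theta> (Suc k) = 1 / 2 * \<theta> k * (sqrt ((\<theta> k)\<^sup>2 + 4) - \<theta> k)"
    "\<And>k. y (Suc k) = z (Suc k) + (\<theta> (Suc k) * (1 / \<theta> k - 1)) *\<^sub>R (z (Suc k) - z k)"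
    using assms(5) unfolding apg_run_def by blast+
  have mem: "z k \<in> primal_dual_set G" for k
    using run(1,4) by (cases k) (auto simp: is_arg_min_def)
  have "dual_gap G (z k) \<le> ?C / (real k)\<^sup>2" if "1 \<le> k" for k
    using accelerated_projected_gradient_rate[OF convex_primal_dual_set apg_L_pos[OF assms(3)]
        dual_gap_lower[OF assms(2)] dual_gap_upper[OF assms(3)] run w(1) that]
    by (simp add: w(2))
  then have "\<forall>k\<ge>1. approx_GNE G (?C / (real k)\<^sup>2) (fst (z k))"
    using approx_GNE_dual_gap[OF assms(1,2) mem] by blast
  moreover have "0 \<le> ?C" using apg_L_pos[OF assms(3)] by simp
  ultimately show ?thesis by blast
qed

end
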